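(* Let $\omega:[0,1]\to\mathbb{R}_{+}$ be a modulus of continuity such that for some $0<\alpha<1$ the function $\frac{\omega(x)}{x^{\alpha}}$ is decreasing on $(0,a(\alpha))$, where $0<a(\alpha)<1$. Then for each $f\in\mathrm{Diff}^{\omega}_0[0,1]$ with $\gamma(f)=1$ there is a constant $C(f)$, not depending on $n$, such that $$\log\Gamma_n(f)\le C(f)\cdot n\,\omega\left(\frac1n\right)\qquad\text{for all } n\in\mathbb{N}.$$
   Context: $\mathrm{Diff}_0[0,1]$ is the group of all $C^1$-smooth diffeomorphisms of $[0,1]$ fixing the end points $0$ and $1$. For $f\in\mathrm{Diff}_0[0,1]$ and $n\in\mathbb{N}$, the growth sequence is $\Gamma_n(f)=\max\{\|(f^n)'\|_\infty,\|(f^{-n})'\|_\infty\}$, where $f^n$ is the $n$-th iterate and $\|\cdot\|_\infty$ is the uniform norm on $[0,1]$; and $\gamma(f)=\lim_{n\to\infty}\sqrt[n]{\Gamma_n(f)}$ (the limit exists by submultiplicativity). A modulus of continuity is a non-decreasing continuous function $\omega:[0,1]\to\mathbb{R}_+=[0,\infty)$ with $\omega(0)=0$ and $\omega(\delta_1+\delta_2)\le\omega(\delta_1)+\omega(\delta_2)$ whenever $\delta_1,\delta_2,\delta_1+\delta_2\in[0,1]$. For a modulus of continuity $\omega$, $\mathrm{Diff}^{\omega}_0[0,1]$ is the set of $f\in\mathrm{Diff}_0[0,1]$ for which there is a constant $K(f)$ with $\omega_{f'}(\delta)\le K(f)\,\omega(\delta)$ for all $\delta\in[0,1]$, where $\omega_{f'}(\delta)=\max_{|x-y|\le\delta}|f'(x)-f'(y)|$.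 *)

theory Defs
  imports "HOL-Analysis.Analysis"
begin

text \<open>
  A self-map of the unit interval is represented by a function on all reals of which only the
  restriction to \<open>{0..1}\<close> matters. Derivatives are therefore taken within \<open>{0..1}\<close>, i.e. they are
  one-sided at the end points.
\<close>

definition deriv01 :: "(real \<Rightarrow> real) \<Rightarrow> real \<Rightarrow> real" where
  "deriv01 g x = vector_derivative g (at x within {0..1})"

definition C1_on01 :: "(real \<Rightarrow> real) \<Rightarrow> bool" where
  "C1_on01 g \<longleftrightarrow> g differentiable_on {0..1} \<and> continuous_on {0..1} (deriv01 g)"

definition inv01 :: "(real \<Rightarrow> real) \<Rightarrow> real \<Rightarrow> real" where
  "inv01 f = inv_into {0..1} f"

definition Diff0 :: "(real \<Rightarrow> real) set" where
  "Diff0 = {f. bij_betw f {0..1} {0..1} \<and> C1_on01 f \<and> C1_on01 (inv01 f) \<and> f 0 = 0 \<and> f 1 = 1}"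

definition sup_norm01 :: "(real \<Rightarrow> real) \<Rightarrow> real" where
  "sup_norm01 g = (SUP x\<in>{0..1}. \<bar>g x\<bar>)"

definition growth_seq :: "(real \<Rightarrow> real) \<Rightarrow> nat \<Rightarrow> real" where
  "growth_seq f n =
     max (sup_norm01 (deriv01 (f ^^ n))) (sup_norm01 (deriv01 (inv01 f ^^ n)))"

definition growth_rate :: "(real \<Rightarrow> real) \<Rightarrow> real" where
  "growth_rate f = lim (\<lambda>n. root n (growth_seq f n))"

definition modulus_of_continuity :: "(real \<Rightarrow> real) \<Rightarrow> bool" where
  "modulus_of_continuity \<omega> \<longleftrightarrow>
     (\<forall>x\<in>{0..1}. \<omega> x \<ge> 0) \<and> mono_on {0..1} \<omega> \<and> continuous_on {0..1} \<omega> \<and> \<omega> 0 = 0 \<and>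
     (\<forall>s\<in>{0..1}. \<forall>t\<in>{0..1}. s + t \<in> {0..1} \<longrightarrow> \<omega> (s + t) \<le> \<omega> s + \<omega> t)"

text \<open>
  For \<open>g\<close> continuous on \<open>{0..1}\<close> and \<open>\<delta> \<ge> 0\<close> the supremum below is attained.
\<close>

definition osc_modulus :: "(real \<Rightarrow> real) \<Rightarrow> real \<Rightarrow> real" where
  "osc_modulus g \<delta> = Sup {\<bar>g x - g y\<bar> | x y. x \<in> {0..1} \<and> y \<in> {0..1} \<and> \<bar>x - y\<bar> \<le> \<delta>}"

definition Diff0_mod :: "(real \<Rightarrow> real) \<Rightarrow> (real \<Rightarrow> real) set" where
  "Diff0_mod \<omega> = {f \<in> Diff0. \<exists>K. \<forall>\<delta>\<in>{0..1}. osc_modulus (deriv01 f) \<delta> \<le> K * \<omega> \<delta>}"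

end

theory Submission
  imports Defs
begin

text \<open>
  Write \<open>x\<^sub>k = f\<^sup>k x\<close> for an orbit, \<open>\<phi> x = f x - x\<close> for the displacement and
  \<open>S\<^sub>n x = (\<Sum>k<n. ln (f' x\<^sub>k))\<close>. Since \<open>(f\<^sup>n)' x = exp (S\<^sub>n x)\<close> and the derivative of \<open>f\<^sup>-\<^sup>n\<close> at
  \<open>f\<^sup>n x\<close> is \<open>exp (- S\<^sub>n x)\<close>, the growth sequence is \<open>exp (sup \<bar>S\<^sub>n\<bar>)\<close> (lemma \<open>growth_seq_eq\<close>), and
  the theorem is a bound \<open>\<bar>S\<^sub>n x\<bar> \<le> C * n * \<omega> (1/n)\<close> that is uniform in \<open>x\<close>.

  The assumption on the growth rate enters only through the fixed points. The numbers \<open>sup \<bar>S\<^sub>n\<bar>\<close>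
  are subadditive in \<open>n\<close>, so the growth rate is a genuine limit, and at a fixed point \<open>p\<close> they
  are at least \<open>n * \<bar>ln (f' p)\<bar>\<close>. Growth rate \<open>1\<close> therefore forces \<open>f' p = 1\<close>.

  Now let \<open>x\<close> be a point that is not fixed.

  \<^item> By the mean value theorem \<open>\<phi> x\<^sub>k\<^sub>+\<^sub>1 = f' \<xi>\<^sub>k * \<phi> x\<^sub>k\<close> with \<open>\<xi>\<^sub>k\<close> between \<open>x\<^sub>k\<close> and \<open>x\<^sub>k\<^sub>+\<^sub>1\<close>. If the
    points \<open>x\<^sub>k\<close> in \<open>S\<^sub>n x\<close> are replaced by \<open>\<xi>\<^sub>k\<close>, the sum telescopes to
    \<open>ln \<bar>\<phi> x\<^sub>n\<bar> - ln \<bar>\<phi> x\<^sub>0\<bar>\<close>. The error is at most a constant times \<open>\<Sum>k<n. \<omega> \<bar>\<phi> x\<^sub>k\<bar>\<close>. The orbit is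
    monotone, so the displacements add up to at most \<open>1\<close>, and subadditivity of \<open>\<omega>\<close> bounds this sum
    by \<open>2 * n * \<omega> (1/n)\<close> (lemmas \<open>sum_displacement_le_one\<close> and \<open>sum_modulus_le\<close>).

  \<^item> It remains to control the change of \<open>ln \<bar>\<phi>\<bar>\<close> along the orbit. As long as \<open>\<bar>\<phi> x\<^sub>k\<bar>\<close> is below
    a constant times \<open>1/n\<^sup>2\<close>, each step changes \<open>ln \<bar>\<phi>\<bar>\<close> by only \<open>O(\<omega> (1/n))\<close>: a function with a
    small value at \<open>x\<close> and no zero nearby cannot have a large derivative at \<open>x\<close>, while near a zero
    of \<open>\<phi>\<close> the derivative is small because it vanishes at the zero (lemma \<open>deriv_near_one\<close>). Above
    that level \<open>ln \<bar>\<phi>\<bar>\<close> itself has size at most \<open>2 * ln n + O(1)\<close>. Hence the total change is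
    \<open>O(n * \<omega> (1/n) + ln n)\<close> (lemmas \<open>rise_le_if_slow_below\<close> and \<open>fall_le_if_slow_below\<close>).

  Finally \<open>ln n = O(n * \<omega> (1/n))\<close>, because \<open>\<omega> x / x powr \<alpha>\<close> is decreasing near \<open>0\<close> for some
  \<open>\<alpha> < 1\<close>, so that \<open>n * \<omega> (1/n)\<close> grows at least like a positive power of \<open>n\<close> (lemma
  \<open>ln_le_modulus\<close>).
\<close>

section \<open>Moduli of continuity\<close>

lemma modulus_nonneg: "modulus_of_continuity \<omega> \<Longrightarrow> 0 \<le> x \<Longrightarrow> x \<le> 1 \<Longrightarrow> 0 \<le> \<omega> x"
  by (auto simp: modulus_of_continuity_def)

lemma modulus_mono: "modulus_of_continuity \<omega> \<Longrightarrow> 0 \<le> x \<Longrightarrow> x \<le> y \<Longrightarrow> y \<le> 1 \<Longrightarrow> \<omega> x \<le> \<omega> y"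
  by (auto simp: modulus_of_continuity_def mono_on_def)

lemma modulus_subadditive:
  "modulus_of_continuity \<omega> \<Longrightarrow> 0 \<le> s \<Longrightarrow> 0 \<le> t \<Longrightarrow> s + t \<le> 1 \<Longrightarrow> \<omega> (s + t) \<le> \<omega> s + \<omega> t"
  unfolding modulus_of_continuity_def by (simp add: Ball_def)

lemma modulus_multiple:
  assumes "modulus_of_continuity \<omega>" "0 \<le> \<delta>" "real j * \<delta> \<le> 1"
  shows "\<omega> (real j * \<delta>) \<le> real j * \<omega> \<delta>"
  using assms(3)
proof (induction j)
  case 0
  then show ?case using assms(1) by (simp add: modulus_of_continuity_def)
next
  case (Suc j)
  have eq: "real (Suc j) * \<delta> = real j * \<delta> + \<delta>" by (simp add: algebra_simps)
  have nn: "0 \<le> real j * \<delta>" using assms(2) by simp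
  have "\<omega> (real j * \<delta> + \<delta>) \<le> \<omega> (real j * \<delta>) + \<omega> \<delta>"
    using assms(1,2) nn Suc.prems eq by (intro modulus_subadditive) auto
  moreover have "\<omega> (real j * \<delta>) \<le> real j * \<omega> \<delta>"
    using Suc nn eq assms(2) by auto
  ultimately show ?case unfolding eq by (simp add: algebra_simps)
qed

lemma modulus_one_le:
  assumes "modulus_of_continuity \<omega>" "n \<ge> 1"
  shows "\<omega> 1 \<le> real n * \<omega> (1 / real n)"
  using modulus_multiple[OF assms(1), of "1 / real n" n] assms(2) by simp

text \<open>
  Subdividing \<open>[0, \<delta>]\<close> into \<open>\<lfloor>n \<delta>\<rfloor>\<close> intervals of length \<open>1/n\<close> and a remainder bounds \<open>\<omega>\<close> by an
  affine function. This replaces concavity, which a modulus need not have.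
\<close>

lemma modulus_affine_bound:
  assumes m: "modulus_of_continuity \<omega>" and n: "n \<ge> 1" and d: "0 \<le> \<delta>" "\<delta> \<le> 1"
  shows "\<omega> \<delta> \<le> (1 + real n * \<delta>) * \<omega> (1 / real n)"
proof -
  define j where "j = nat \<lfloor>real n * \<delta>\<rfloor>"
  have nd: "0 \<le> real n * \<delta>" using d by simp
  have j: "real j \<le> real n * \<delta>" "real n * \<delta> < real j + 1"
    using nd unfolding j_def by linarith+
  define r where "r = \<delta> - real j * (1 / real n)"
  have r: "0 \<le> r" using j n by (simp add: r_def field_simps)
  have "real n * r \<le> 1" using j n by (simp add: r_def algebra_simps)
  with r have r: "0 \<le> r" "r \<le> 1 / real n" using n by (auto simp: field_simps)
  have n1: "1 / real n \<le> 1" using n by simp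
  have jn: "0 \<le> real j * (1 / real n)" "real j * (1 / real n) \<le> 1"
    using r d unfolding r_def by (simp, linarith)
  have "\<omega> \<delta> = \<omega> (real j * (1 / real n) + r)" by (simp add: r_def)
  also have "\<dots> \<le> \<omega> (real j * (1 / real n)) + \<omega> r"
    using jn r d by (intro modulus_subadditive[OF m]) (auto simp: r_def)
  also have "\<dots> \<le> real j * \<omega> (1 / real n) + \<omega> (1 / real n)"
    using modulus_multiple[OF m _ jn(2)] modulus_mono[OF m r n1] n by (intro add_mono) auto
  also have "\<dots> = (1 + real j) * \<omega> (1 / real n)" by (simp add: algebra_simps)
  also have "\<dots> \<le> (1 + real n * \<delta>) * \<omega> (1 / real n)"
    using j modulus_nonneg[OF m _ n1] by (intro mult_right_mono) auto
  finally show ?thesis .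
qed

text \<open>
  A substitute for Jensen's inequality: up to a factor \<open>2\<close>, equal increments are the worst case.
\<close>

lemma sum_modulus_le:
  assumes m: "modulus_of_continuity \<omega>" and n: "n \<ge> 1"
    and d: "\<And>k. k < n \<Longrightarrow> 0 \<le> \<delta> k" and s: "(\<Sum>k<n. \<delta> k) \<le> 1"
  shows "(\<Sum>k<n. \<omega> (\<delta> k)) \<le> 2 * (real n * \<omega> (1 / real n))"
proof -
  have d1: "\<delta> k \<le> 1" if "k < n" for k
    using member_le_sum[of k "{..<n}" \<delta>] that d s by force
  have w: "0 \<le> \<omega> (1 / real n)" using modulus_nonneg[OF m] n by simp
  have "(\<Sum>k<n. \<omega> (\<delta> k)) \<le> (\<Sum>k<n. (1 + real n * \<delta> k) * \<omega> (1 / real n))"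
    using modulus_affine_bound[OF m n d d1] by (intro sum_mono) auto
  also have "\<dots> = (real n + real n * (\<Sum>k<n. \<delta> k)) * \<omega> (1 / real n)"
    by (simp add: sum_distrib_right[symmetric] sum.distrib sum_distrib_left)
  also have "\<dots> \<le> (real n + real n * 1) * \<omega> (1 / real n)"
    using s w by (intro mult_right_mono add_left_mono mult_left_mono) auto
  finally show ?thesis by (simp add: algebra_simps)
qed

text \<open>
  The monotone quotient gives \<open>\<omega> (1/n) \<ge> c * n powr (- \<alpha>)\<close> once \<open>1/n\<close> is well inside \<open>(0, a)\<close>, and
  \<open>n powr (1 - \<alpha>)\<close> dominates the logarithm. For the finitely many smaller \<open>n\<close> the logarithm is
  bounded while \<open>n * \<omega> (1/n) \<ge> \<omega> 1\<close>.
\<close>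

lemma ln_le_modulus:
  assumes m: "modulus_of_continuity \<omega>" and pos: "0 < \<omega> 1"
    and al: "\<alpha> < 1" and a: "0 < a" "a < 1"
    and anti: "antimono_on {0<..<a} (\<lambda>x. \<omega> x / x powr \<alpha>)"
  obtains C where "0 \<le> C" "\<And>n. n \<ge> 1 \<Longrightarrow> ln (real n) \<le> C * (real n * \<omega> (1 / real n))"
proof -
  define c where "c = \<omega> (a / 2) / (a / 2) powr \<alpha>"
  obtain N :: nat where N: "1 / real (Suc N) < a / 2"
    using nat_approx_posE[of "a/2"] a by auto
  have "0 < real (Suc N) * \<omega> (1 / real (Suc N))"
    using modulus_one_le[OF m, of "Suc N"] pos by simp
  then have "0 < \<omega> (1 / real (Suc N))" by (simp add: zero_less_mult_iff)
  also have "\<dots> \<le> \<omega> (a / 2)" using N a by (intro modulus_mono[OF m]) auto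
  finally have c: "0 < c" using a by (simp add: c_def)
  define C where "C = ln (2 / a) / \<omega> 1 + 1 / (c * (1 - \<alpha>))"
  have l: "0 \<le> ln (2 / a)" using a by simp
  have C1: "ln (2 / a) / \<omega> 1 \<le> C" and C2: "1 / (c * (1 - \<alpha>)) \<le> C" and C0: "0 \<le> C"
    using l c al pos by (auto simp: C_def)
  have "ln (real n) \<le> C * (real n * \<omega> (1 / real n))" if n: "n \<ge> 1" for n
  proof (cases "real n \<le> 2 / a")
    case True
    have "ln (real n) \<le> ln (2 / a)" using True n a by simp
    also have "\<dots> = ln (2 / a) / \<omega> 1 * \<omega> 1" using pos by simp
    also have "\<dots> \<le> C * (real n * \<omega> (1 / real n))"
      using C1 C0 modulus_one_le[OF m n] pos by (intro mult_mono) auto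
    finally show ?thesis .
  next
    case False
    then have n2: "1 / real n \<le> a / 2" using a n by (simp add: field_simps)
    have "c \<le> \<omega> (1 / real n) / (1 / real n) powr \<alpha>"
      using monotone_onD[OF anti, of "1 / real n" "a / 2"] a n n2 by (auto simp: c_def)
    also have "\<dots> = \<omega> (1 / real n) * real n powr \<alpha>"
      using n by (simp add: powr_divide)
    finally have "c * real n powr (1 - \<alpha>) \<le> \<omega> (1 / real n) * real n powr \<alpha> * real n powr (1 - \<alpha>)"
      by (intro mult_right_mono) auto
    also have "\<dots> = real n * \<omega> (1 / real n)"
      using n by (simp add: mult.assoc powr_add[symmetric])
    finally have low: "real n powr (1 - \<alpha>) \<le> real n * \<omega> (1 / real n) / c"
      using c by (simp add: field_simps)
    have "ln (real n) \<le> real n powr (1 - \<alpha>) / (1 - \<alpha>)"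
      using n al by (intro ln_powr_bound) auto
    also have "\<dots> \<le> real n * \<omega> (1 / real n) / c / (1 - \<alpha>)"
      using low al by (intro divide_right_mono) auto
    also have "\<dots> = 1 / (c * (1 - \<alpha>)) * (real n * \<omega> (1 / real n))" by simp
    also have "\<dots> \<le> C * (real n * \<omega> (1 / real n))"
      using C2 modulus_nonneg[OF m, of "1 / real n"] n by (intro mult_right_mono) auto
    finally show ?thesis .
  qed
  with C0 show ?thesis by (rule that)
qed

section \<open>Sequences of real numbers\<close>

lemma subadditive_multiple:
  fixes s :: "nat \<Rightarrow> real"
  assumes sub: "\<And>m n. s (m + n) \<le> s m + s n"
  shows "s (q * j + r) \<le> real j * s q + s r"
proof (induction j)
  case (Suc j)
  have "s (q + (q * j + r)) \<le> s q + s (q * j + r)" by (rule sub)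
  with Suc show ?case by (simp add: algebra_simps)
qed simp

text \<open>
  Fekete's lemma for nonnegative sequences: the limit is the infimum of the quotients, which is
  nearly attained at some \<open>q\<close> and, after division with remainder by \<open>q\<close>, at all large \<open>n\<close>.
\<close>

lemma subadditive_convergent:
  fixes s :: "nat \<Rightarrow> real"
  assumes sub: "\<And>m n. s (m + n) \<le> s m + s n" and nn: "\<And>n. 0 \<le> s n"
  shows "convergent (\<lambda>n. s n / real n)"
proof -
  define L where "L = (INF n\<in>{1..}. s n / real n)"
  have bdd: "bdd_below ((\<lambda>n. s n / real n) ` {1..})"
    using nn by (intro bdd_belowI2[of _ 0]) auto
  have low: "L \<le> s n / real n" if "n \<ge> 1" for n
    unfolding L_def using bdd that by (intro cINF_lower) auto
  have "(\<lambda>n. s n / real n) \<longlonglongrightarrow> L"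
  proof (rule LIMSEQ_I)
    fix e :: real assume e: "0 < e"
    obtain q where q: "q \<ge> 1" "s q / real q < L + e / 2"
      using cINF_less_iff[OF _ bdd, of "L + e / 2"] e unfolding L_def by auto
    define R where "R = (\<Sum>r<q. s r)"
    obtain N where N: "R / (e / 2) < real N" using reals_Archimedean2 by blast
    have "norm (s n / real n - L) < e" if n: "n \<ge> max 1 N" for n
    proof -
      have n0: "real n > 0" using n by simp
      have "s n \<le> real (n div q) * s q + s (n mod q)"
        using subadditive_multiple[OF sub, of q "n div q" "n mod q"] by simp
      moreover have "s (n mod q) \<le> R"
        unfolding R_def using nn q by (intro member_le_sum) auto
      moreover have "real (n div q) * s q \<le> real n / real q * s q"
      proof -
        have "real (n div q * q) \<le> real n" by (subst of_nat_le_iff) simp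
        then have "real (n div q) \<le> real n / real q" using q by (simp add: field_simps)
        then show ?thesis by (rule mult_right_mono[OF _ nn])
      qed
      ultimately have "s n \<le> real n * (s q / real q) + R" by simp
      then have "s n / real n \<le> (real n * (s q / real q) + R) / real n"
        using n0 by (intro divide_right_mono) auto
      also have "\<dots> = s q / real q + R / real n"
        using n0 by (simp add: add_divide_distrib)
      also have "R / real n < e / 2"
      proof -
        have "R / (e / 2) < real n" using N n by simp
        then show ?thesis using e n0 by (simp add: field_simps)
      qed
      finally have "s n / real n < L + e" using q by simp
      with low[of n] n show ?thesis by simp
    qed
    then show "\<exists>N. \<forall>n\<ge>N. norm (s n / real n - L) < e" by blast
  qed
  then show ?thesis by (rule convergentI)
qed

text \<open>
  The next two lemmas bound the change of a nonpositive sequence that moves slowly below the level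
  \<open>- B\<close>. If the sequence starts above this level, it can rise by at most \<open>B\<close>. Otherwise its first
  step is slow, and the induction passes to the shifted sequence.
\<close>

lemma rise_le_if_slow_below:
  fixes L :: "nat \<Rightarrow> real"
  assumes "\<And>k. L k \<le> 0" "0 \<le> B" "0 \<le> \<epsilon>"
    and "\<And>k. L k \<le> - B \<Longrightarrow> \<bar>L (Suc k) - L k\<bar> \<le> \<epsilon>"
  shows "L n - L 0 \<le> B + real n * \<epsilon>"
  using assms
proof (induction n arbitrary: L)
  case (Suc n)
  show ?case
  proof (cases "L 0 \<le> - B")
    case True
    have "L (Suc n) - L (Suc 0) \<le> B + real n * \<epsilon>"
      using Suc.IH[of "\<lambda>k. L (Suc k)"] Suc.prems by blast
    moreover have "\<bar>L (Suc 0) - L 0\<bar> \<le> \<epsilon>" using Suc.prems(4) True by blast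
    ultimately show ?thesis by (simp add: algebra_simps)
  next
    case False
    have "0 \<le> real (Suc n) * \<epsilon>" using Suc.prems by simp
    with False Suc.prems(1)[of "Suc n"] show ?thesis by linarith
  qed
qed simp

text \<open>
  A falling sequence crosses the level \<open>- B\<close> by a step that starts above it and hence need not be
  slow. Only the last such crossing matters, because all later steps are slow, so the additional
  cost is one \<open>M\<close>.
\<close>

lemma fall_le_if_slow_below:
  fixes L :: "nat \<Rightarrow> real"
  assumes neg: "\<And>k. L k \<le> 0" and B: "0 \<le> B" "0 \<le> \<epsilon>" "0 \<le> M"
    and slow: "\<And>k. L k \<le> - B \<Longrightarrow> \<bar>L (Suc k) - L k\<bar> \<le> \<epsilon>"
    and step: "\<And>k. \<bar>L (Suc k) - L k\<bar> \<le> M"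
  shows "L 0 - L n \<le> B + M + real n * \<epsilon>"
proof (induction n)
  case (Suc n)
  show ?case
  proof (cases "L n \<le> - B")
    case True
    from slow[OF this] Suc show ?thesis by (simp add: algebra_simps)
  next
    case False
    have "0 \<le> real (Suc n) * \<epsilon>" using B by simp
    with False neg[of 0] step[of n] show ?thesis by linarith
  qed
qed (use B in simp)

section \<open>Diffeomorphisms of the interval\<close>

lemma deriv01_eqI:
  assumes "(g has_real_derivative d) (at x within {0..1})" "x \<in> {0..1}"
  shows "deriv01 g x = d"
  using vector_derivative_within_cbox[where a = 0 and b = 1 and f = g and f' = d and x = x] assms
  by (simp add: deriv01_def has_real_derivative_iff_has_vector_derivative)

lemma C1_on01_has_derivative:
  assumes "C1_on01 g" "x \<in> {0..1}"
  shows "(g has_real_derivative deriv01 g x) (at x within {0..1})"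
  using assms
  by (auto simp: C1_on01_def differentiable_on_def deriv01_def
      has_real_derivative_iff_has_vector_derivative vector_derivative_works[symmetric])

text \<open>
  The mean value theorem for one-sided derivatives at the end points. The order of \<open>u\<close> and \<open>v\<close> is
  left open so that orbits moving to the left and to the right can be treated at once.
\<close>

lemma mean_value01:
  fixes g :: "real \<Rightarrow> real"
  assumes der: "\<And>x. x \<in> {0..1} \<Longrightarrow> (g has_real_derivative g' x) (at x within {0..1})"
    and u: "u \<in> {0..1}" and v: "v \<in> {0..1}"
  obtains \<xi> where "\<xi> \<in> {0..1}" "\<bar>\<xi> - u\<bar> \<le> \<bar>v - u\<bar>" "g v - g u = g' \<xi> * (v - u)"
proof -
  have main: "\<exists>\<xi>\<in>{a..b}. g b - g a = g' \<xi> * (b - a)"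
    if "a \<le> b" "a \<in> {0..1}" "b \<in> {0..1}" for a b
  proof -
    have "(g has_derivative (\<lambda>h. g' x * h)) (at x within {a..b})" if "a \<le> x" "x \<le> b" for x
    proof -
      have "(g has_real_derivative g' x) (at x within {a..b})"
        using der[of x] that \<open>a \<in> {0..1}\<close> \<open>b \<in> {0..1}\<close>
        by (auto intro: has_field_derivative_subset)
      then show ?thesis by (simp add: has_field_derivative_def)
    qed
    from mvt_very_simple[OF \<open>a \<le> b\<close>, of g "\<lambda>x h. g' x * h"] this show ?thesis by auto
  qed
  show ?thesis
  proof (cases "u \<le> v")
    case True
    from main[OF this u v] obtain \<xi> where "\<xi> \<in> {u..v}" "g v - g u = g' \<xi> * (v - u)" by blast
    then show ?thesis using u v by (intro that[of \<xi>]) auto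
  next
    case False
    then obtain \<xi> where "\<xi> \<in> {v..u}" "g u - g v = g' \<xi> * (u - v)"
      using main[of v u] u v by auto
    then show ?thesis using u v by (intro that[of \<xi>]) (auto simp: algebra_simps)
  qed
qed

lemma iterate_in01:
  fixes g :: "real \<Rightarrow> real"
  assumes "\<And>x. x \<in> {0..1} \<Longrightarrow> g x \<in> {0..1}" "x \<in> {0..1}"
  shows "(g ^^ n) x \<in> {0..1}"
proof (induction n)
  case (Suc n)
  from assms(1)[OF this] show ?case by simp
qed (use assms(2) in simp)

lemma iterate_has_derivative01:
  fixes g :: "real \<Rightarrow> real"
  assumes maps: "\<And>x. x \<in> {0..1} \<Longrightarrow> g x \<in> {0..1}"
    and der: "\<And>x. x \<in> {0..1} \<Longrightarrow> (g has_real_derivative g' x) (at x within {0..1})"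
    and x: "x \<in> {0..1}"
  shows "((g ^^ n) has_real_derivative (\<Prod>k<n. g' ((g ^^ k) x))) (at x within {0..1})"
proof (induction n)
  case 0
  show ?case by (simp add: id_def)
next
  case (Suc n)
  have "(g has_real_derivative g' ((g ^^ n) x)) (at ((g ^^ n) x) within (g ^^ n) ` {0..1})"
    by (rule has_field_derivative_subset[OF der])
      (use iterate_in01[of g, OF maps] x in blast)+
  from DERIV_image_chain[OF this Suc] show ?case by (simp add: mult.commute o_def)
qed

locale interval_diffeo =
  fixes f :: "real \<Rightarrow> real"
  assumes diffeo: "f \<in> Diff0"
begin

lemma bij: "bij_betw f {0..1} {0..1}"
  and f_zero: "f 0 = 0" and f_one: "f 1 = 1"
  and C1: "C1_on01 f" and C1_inv: "C1_on01 (inv01 f)"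
  using diffeo by (auto simp: Diff0_def)

lemma maps: "x \<in> {0..1} \<Longrightarrow> f x \<in> {0..1}"
  using bij by (rule bij_betwE[rule_format])

lemma inv_maps: "x \<in> {0..1} \<Longrightarrow> inv01 f x \<in> {0..1}"
  using bij_betw_inv_into[OF bij] unfolding inv01_def by (rule bij_betwE[rule_format])

lemma inv_left: "x \<in> {0..1} \<Longrightarrow> inv01 f (f x) = x"
  using bij unfolding inv01_def by (rule bij_betw_inv_into_left)

lemma inv_right: "x \<in> {0..1} \<Longrightarrow> f (inv01 f x) = x"
  using bij unfolding inv01_def by (rule bij_betw_inv_into_right)

lemma iterate_maps: "x \<in> {0..1} \<Longrightarrow> (f ^^ n) x \<in> {0..1}"
  by (rule iterate_in01[OF maps])

lemma inv_iterate_maps: "x \<in> {0..1} \<Longrightarrow> (inv01 f ^^ n) x \<in> {0..1}"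
  by (rule iterate_in01[OF inv_maps])

lemma inv_iterate_left: "x \<in> {0..1} \<Longrightarrow> (inv01 f ^^ n) ((f ^^ n) x) = x"
proof (induction n)
  case (Suc n)
  have "(inv01 f ^^ Suc n) ((f ^^ Suc n) x) = (inv01 f ^^ n) (inv01 f (f ((f ^^ n) x)))"
    by (simp add: funpow_swap1)
  with Suc inv_left[OF iterate_maps[OF Suc.prems]] show ?case by simp
qed simp

lemma inv_iterate_right: "x \<in> {0..1} \<Longrightarrow> (f ^^ n) ((inv01 f ^^ n) x) = x"
proof (induction n)
  case (Suc n)
  have "(f ^^ Suc n) ((inv01 f ^^ Suc n) x) = (f ^^ n) (f (inv01 f ((inv01 f ^^ n) x)))"
    by (simp add: funpow_swap1)
  with Suc inv_right[OF inv_iterate_maps[OF Suc.prems]] show ?case by simp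
qed simp

lemmas has_deriv = C1_on01_has_derivative[OF C1]
lemmas inv_has_deriv = C1_on01_has_derivative[OF C1_inv]

lemma iterate_has_deriv:
  assumes x: "x \<in> {0..1}"
  shows "((f ^^ n) has_real_derivative deriv01 (f ^^ n) x) (at x within {0..1})"
    and "deriv01 (f ^^ n) x = (\<Prod>k<n. deriv01 f ((f ^^ k) x))"
proof -
  have d: "((f ^^ n) has_real_derivative (\<Prod>k<n. deriv01 f ((f ^^ k) x))) (at x within {0..1})"
    by (rule iterate_has_derivative01[OF maps has_deriv x])
  show eq: "deriv01 (f ^^ n) x = (\<Prod>k<n. deriv01 f ((f ^^ k) x))"
    using d x by (rule deriv01_eqI)
  show "((f ^^ n) has_real_derivative deriv01 (f ^^ n) x) (at x within {0..1})"
    unfolding eq by (rule d)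
qed

lemma inv_iterate_has_deriv:
  assumes x: "x \<in> {0..1}"
  shows "((inv01 f ^^ n) has_real_derivative deriv01 (inv01 f ^^ n) x) (at x within {0..1})"
proof -
  have d: "((inv01 f ^^ n) has_real_derivative (\<Prod>k<n. deriv01 (inv01 f) ((inv01 f ^^ k) x)))
      (at x within {0..1})"
    by (rule iterate_has_derivative01[OF inv_maps inv_has_deriv x])
  show ?thesis unfolding deriv01_eqI[OF d x] by (rule d)
qed

lemma deriv_inv_iterate_mult:
  assumes x: "x \<in> {0..1}"
  shows "deriv01 (inv01 f ^^ n) ((f ^^ n) x) * deriv01 (f ^^ n) x = 1"
proof -
  have y: "(f ^^ n) x \<in> {0..1}" by (rule iterate_maps[OF x])
  have "((inv01 f ^^ n) has_real_derivative deriv01 (inv01 f ^^ n) ((f ^^ n) x))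
      (at ((f ^^ n) x) within {0..1})"
    by (rule inv_iterate_has_deriv[OF y])
  then have "((inv01 f ^^ n) has_real_derivative deriv01 (inv01 f ^^ n) ((f ^^ n) x))
      (at ((f ^^ n) x) within (f ^^ n) ` {0..1})"
    by (rule has_field_derivative_subset) (use iterate_maps in blast)
  from DERIV_image_chain[OF this iterate_has_deriv(1)[OF x]]
  have "((\<lambda>t. t) has_real_derivative
      deriv01 (inv01 f ^^ n) ((f ^^ n) x) * deriv01 (f ^^ n) x) (at x within {0..1})"
    by (rule has_field_derivative_transform_within[of _ _ _ _ 1])
      (use x inv_iterate_left in auto)
  from deriv01_eqI[OF this x] deriv01_eqI[OF DERIV_ident x] show ?thesis by simp
qed

text \<open>
  The derivative has no zero because \<open>f\<close> has a differentiable inverse, and it takes the value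
  \<open>f 1 - f 0 = 1\<close> somewhere. By continuity it cannot be negative.
\<close>

lemma deriv_pos:
  assumes x: "x \<in> {0..1}"
  shows "0 < deriv01 f x"
proof (rule ccontr)
  assume neg: "\<not> 0 < deriv01 f x"
  obtain \<xi> where xi: "\<xi> \<in> {0..1}" "f 1 - f 0 = deriv01 f \<xi> * (1 - 0)"
    using mean_value01[of f "deriv01 f" 0 1] has_deriv by auto
  have "connected (deriv01 f ` {0..1})"
    using C1 by (intro connected_continuous_image) (auto simp: C1_on01_def)
  then have "{deriv01 f x..deriv01 f \<xi>} \<subseteq> deriv01 f ` {0..1}"
    using x xi(1) by (intro connected_contains_Icc) auto
  moreover have "0 \<in> {deriv01 f x..deriv01 f \<xi>}" using xi neg f_zero f_one by auto
  ultimately obtain z where "z \<in> {0..1}" "deriv01 f z = 0" by (metis (no_types) imageE subsetD)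
  with deriv_inv_iterate_mult[of z 1] show False by simp
qed

lemma deriv_bounds:
  obtains m M where "0 < m" "\<And>x. x \<in> {0..1} \<Longrightarrow> m \<le> deriv01 f x"
    "0 \<le> M" "\<And>x. x \<in> {0..1} \<Longrightarrow> \<bar>ln (deriv01 f x)\<bar> \<le> M"
proof -
  have cont: "continuous_on {0..1} (deriv01 f)" using C1 by (simp add: C1_on01_def)
  obtain u where u: "u \<in> {0..1}" "\<And>x. x \<in> {0..1} \<Longrightarrow> deriv01 f u \<le> deriv01 f x"
    using continuous_attains_inf[OF _ _ cont] by auto
  have "continuous_on {0..1} (\<lambda>x. \<bar>ln (deriv01 f x)\<bar>)"
    using cont deriv_pos by (intro continuous_intros) (force dest: less_imp_neq)+
  then obtain v where v: "\<And>x. x \<in> {0..1} \<Longrightarrow> \<bar>ln (deriv01 f x)\<bar> \<le> \<bar>ln (deriv01 f v)\<bar>"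
    using continuous_attains_sup[of "{0..1::real}"] by fastforce
  show ?thesis
    by (rule that[of "deriv01 f u" "\<bar>ln (deriv01 f v)\<bar>"]) (use u v deriv_pos in auto)
qed

definition log_deriv_sum :: "nat \<Rightarrow> real \<Rightarrow> real" where
  "log_deriv_sum n x = (\<Sum>k<n. ln (deriv01 f ((f ^^ k) x)))"

lemma deriv_iterate:
  assumes x: "x \<in> {0..1}"
  shows "deriv01 (f ^^ n) x = exp (log_deriv_sum n x)"
proof -
  have "deriv01 (f ^^ n) x = (\<Prod>k<n. exp (ln (deriv01 f ((f ^^ k) x))))"
    unfolding iterate_has_deriv(2)[OF x] using deriv_pos[OF iterate_maps[OF x]] by simp
  then show ?thesis by (simp add: log_deriv_sum_def exp_sum)
qed

lemma deriv_inv_iterate: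
  assumes x: "x \<in> {0..1}"
  shows "deriv01 (inv01 f ^^ n) ((f ^^ n) x) = exp (- log_deriv_sum n x)"
  using deriv_inv_iterate_mult[OF x, of n] by (simp add: deriv_iterate[OF x] exp_minus field_simps)

lemma log_deriv_sum_bdd: "bdd_above ((\<lambda>x. \<bar>log_deriv_sum n x\<bar>) ` {0..1})"
proof -
  obtain M where M: "\<And>x. x \<in> {0..1} \<Longrightarrow> \<bar>ln (deriv01 f x)\<bar> \<le> M"
    using deriv_bounds by metis
  have "\<bar>log_deriv_sum n x\<bar> \<le> real n * M" if "x \<in> {0..1}" for x
  proof -
    have "\<bar>log_deriv_sum n x\<bar> \<le> (\<Sum>k<n. \<bar>ln (deriv01 f ((f ^^ k) x))\<bar>)"
      unfolding log_deriv_sum_def by (rule sum_abs)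
    also have "\<dots> \<le> (\<Sum>k<n. M)" by (intro sum_mono M iterate_maps that)
    finally show ?thesis by simp
  qed
  then show ?thesis by (intro bdd_aboveI2)
qed

text \<open>
  The derivatives of the forward iterates detect large positive values of the sum and those of the
  backward iterates large negative ones. Both suprema can be taken over the same points \<open>x\<close>, because
  \<open>f\<^sup>n\<close> maps the interval onto itself.
\<close>

lemma growth_seq_eq: "growth_seq f n = exp (SUP x\<in>{0..1}. \<bar>log_deriv_sum n x\<bar>)" (is "_ = exp ?s")
proof (rule antisym)
  have up: "\<bar>log_deriv_sum n x\<bar> \<le> ?s" if "x \<in> {0..1}" for x
    using that log_deriv_sum_bdd by (rule cSUP_upper)
  have fwd: "\<bar>deriv01 (f ^^ n) x\<bar> \<le> exp ?s" if "x \<in> {0..1}" for x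
    using up[OF that] by (simp add: deriv_iterate[OF that])
  have bwd: "\<bar>deriv01 (inv01 f ^^ n) y\<bar> \<le> exp ?s" if y: "y \<in> {0..1}" for y
    using deriv_inv_iterate[OF inv_iterate_maps[OF y, of n], of n] up[OF inv_iterate_maps[OF y, of n]]
    by (simp add: inv_iterate_right[OF y])
  show "growth_seq f n \<le> exp ?s"
    unfolding growth_seq_def sup_norm01_def using fwd bwd by (auto intro!: cSUP_least)
  have low: "exp \<bar>log_deriv_sum n x\<bar> \<le> growth_seq f n" if x: "x \<in> {0..1}" for x
  proof -
    have "exp (log_deriv_sum n x) \<le> sup_norm01 (deriv01 (f ^^ n))"
      using cSUP_upper[OF x bdd_aboveI2[of _ "\<lambda>x. \<bar>deriv01 (f ^^ n) x\<bar>", OF fwd]]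
      unfolding sup_norm01_def by (simp add: deriv_iterate[OF x])
    moreover have "exp (- log_deriv_sum n x) \<le> sup_norm01 (deriv01 (inv01 f ^^ n))"
      using cSUP_upper[OF iterate_maps[OF x, of n]
          bdd_aboveI2[of _ "\<lambda>x. \<bar>deriv01 (inv01 f ^^ n) x\<bar>", OF bwd]]
      unfolding sup_norm01_def by (simp add: deriv_inv_iterate[OF x])
    ultimately show ?thesis
      unfolding growth_seq_def by (cases "0 \<le> log_deriv_sum n x")
        (simp_all add: max.coboundedI1 max.coboundedI2)
  qed
  have pos: "0 < growth_seq f n" using low[of 0] by (intro less_le_trans[OF exp_gt_zero]) auto
  have "?s \<le> ln (growth_seq f n)"
    using low by (intro cSUP_least) (auto simp: ln_ge_iff[OF pos])
  then show "exp ?s \<le> growth_seq f n" by (simp add: ln_ge_iff[OF pos])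
qed

lemma log_deriv_sum_add:
  "log_deriv_sum (m + n) x = log_deriv_sum m x + log_deriv_sum n ((f ^^ m) x)"
  by (induction n) (simp_all add: log_deriv_sum_def funpow_add add.commute[of m] )

text \<open>
  \<open>growth_rate\<close> is defined by \<open>lim\<close>, which is meaningful only for a convergent sequence, so
  convergence has to be derived from subadditivity before the value \<open>1\<close> can be used.
\<close>

lemma deriv_fixed_point:
  assumes rate: "growth_rate f = 1" and p: "p \<in> {0..1}" "f p = p"
  shows "deriv01 f p = 1"
proof -
  define s where "s n = (SUP x\<in>{0..1}. \<bar>log_deriv_sum n x\<bar>)" for n
  have up: "\<bar>log_deriv_sum n x\<bar> \<le> s n" if "x \<in> {0..1}" for n x
    unfolding s_def using that log_deriv_sum_bdd by (rule cSUP_upper)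
  have nn: "0 \<le> s n" for n using up[of 0 n] by simp
  have "s (m + n) \<le> s m + s n" for m n
    unfolding s_def[of "m + n"]
  proof (rule cSUP_least)
    fix x :: real assume x: "x \<in> {0..1}"
    show "\<bar>log_deriv_sum (m + n) x\<bar> \<le> s m + s n"
      using up[OF x, of m] up[OF iterate_maps[OF x, of m], of n] by (simp add: log_deriv_sum_add)
  qed simp
  then obtain l where l: "(\<lambda>n. s n / real n) \<longlonglongrightarrow> l"
    using subadditive_convergent[of s] nn by (auto simp: convergent_def)
  have "(\<lambda>n. root n (growth_seq f n)) \<longlonglongrightarrow> exp l"
  proof (rule Lim_transform_eventually[OF tendsto_exp[OF l]])
    show "\<forall>\<^sub>F n in sequentially. exp (s n / real n) = root n (growth_seq f n)"
      using eventually_gt_at_top[of 0]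
    proof eventually_elim
      case (elim n)
      have "exp (s n / real n) ^ n = growth_seq f n"
        using elim by (simp add: exp_of_nat_mult[symmetric] growth_seq_eq s_def)
      with elim show ?case by (metis exp_ge_zero real_root_power_cancel)
    qed
  qed
  then have l0: "l = 0" using rate limI unfolding growth_rate_def by fastforce
  have orbit: "(f ^^ k) p = p" for k by (induction k) (auto simp: p)
  have "\<bar>ln (deriv01 f p)\<bar> \<le> s n / real n" if "n \<ge> 1" for n
    using up[OF p(1), of n] that by (simp add: log_deriv_sum_def orbit field_simps abs_mult)
  then have "\<bar>ln (deriv01 f p)\<bar> \<le> l" by (intro LIMSEQ_le_const[OF l]) auto
  with l0 deriv_pos[OF p(1)] show ?thesis by simp
qed

text \<open>
  The derivative \<open>f' x - 1\<close> of the displacement is small where the displacement is small. If a fixed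
  point lies within distance \<open>h\<close>, the oscillation bound \<open>w\<close> suffices. Otherwise \<open>[x - h, x + h]\<close> lies
  inside the unit interval, whose end points are fixed. If the bound
  failed, the derivative of the displacement would keep its sign on this interval and exceed
  \<open>\<bar>f x - x\<bar> / h\<close> in absolute value, so the displacement would have opposite signs at \<open>x - h\<close> and
  \<open>x + h\<close>, which yields a fixed point after all.
\<close>

lemma deriv_near_one:
  assumes fixed: "\<And>p. p \<in> {0..1} \<Longrightarrow> f p = p \<Longrightarrow> deriv01 f p = 1"
    and osc: "\<And>u v. u \<in> {0..1} \<Longrightarrow> v \<in> {0..1} \<Longrightarrow> \<bar>u - v\<bar> \<le> h \<Longrightarrow> \<bar>deriv01 f u - deriv01 f v\<bar> \<le> w"
    and h: "0 < h" and x: "x \<in> {0..1}"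
  shows "\<bar>deriv01 f x - 1\<bar> \<le> \<bar>f x - x\<bar> / h + w"
proof (rule ccontr)
  assume neg: "\<not> ?thesis"
  have no_fix: "f p \<noteq> p" if "p \<in> {0..1}" "\<bar>x - p\<bar> \<le> h" for p
  proof
    assume "f p = p"
    then have "\<bar>deriv01 f x - 1\<bar> \<le> w" using osc[OF x that] fixed that by simp
    moreover have "0 \<le> \<bar>f x - x\<bar> / h" using h by simp
    ultimately show False using neg by linarith
  qed
  have "\<not> \<bar>x - 0\<bar> \<le> h" "\<not> \<bar>x - 1\<bar> \<le> h"
    using no_fix[of 0] no_fix[of 1] f_zero f_one by auto
  then have in01: "x - h \<in> {0..1}" "x + h \<in> {0..1}" using x h by auto
  have der: "((\<lambda>x. f x - x) has_real_derivative (deriv01 f x - 1)) (at x within {0..1})"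
    if "x \<in> {0..1}" for x
    using has_deriv[OF that] by (auto intro!: derivative_eq_intros)
  obtain y where y: "y \<in> {0..1}" "\<bar>y - x\<bar> \<le> h" "f (x + h) - (x + h) - (f x - x) = (deriv01 f y - 1) * h"
    using mean_value01[OF der x in01(2)] h by auto
  obtain z where z: "z \<in> {0..1}" "\<bar>z - x\<bar> \<le> h" "f (x - h) - (x - h) - (f x - x) = (deriv01 f z - 1) * - h"
    using mean_value01[OF der x in01(1)] h by auto
  have "\<bar>f x - x\<bar> / h < \<bar>deriv01 f x - 1\<bar> - w" using neg by linarith
  then have big: "\<bar>f x - x\<bar> < (\<bar>deriv01 f x - 1\<bar> - w) * h" using h by (simp add: field_simps)
  have ty: "\<bar>deriv01 f x - deriv01 f y\<bar> \<le> w" using osc[OF x y(1)] y(2) by (simp add: abs_minus_commute)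
  have tz: "\<bar>deriv01 f x - deriv01 f z\<bar> \<le> w" using osc[OF x z(1)] z(2) by (simp add: abs_minus_commute)
  have sub: "{x - h..x + h} \<subseteq> {0..1}" using in01 by auto
  define J where "J = (\<lambda>x. f x - x) ` {x - h..x + h}"
  have "connected J"
    unfolding J_def
  proof (intro connected_continuous_image)
    have "continuous_on {0..1} (\<lambda>x. f x - x)" using der by (rule DERIV_continuous_on)
    then show "continuous_on {x - h..x + h} (\<lambda>x. f x - x)" by (rule continuous_on_subset[OF _ sub])
  qed simp
  then have icc: "{s..t} \<subseteq> J" if "s \<in> J" "t \<in> J" for s t
    using that by (rule connected_contains_Icc)
  have mem: "f (x - h) - (x - h) \<in> J" "f (x + h) - (x + h) \<in> J" using h by (auto simp: J_def)
  have "f (x - h) - (x - h) \<le> 0 \<and> 0 \<le> f (x + h) - (x + h) \<or>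
     f (x + h) - (x + h) \<le> 0 \<and> 0 \<le> f (x - h) - (x - h)"
  proof (cases "0 \<le> deriv01 f x - 1")
    case True
    have "(\<bar>deriv01 f x - 1\<bar> - w) * h \<le> (deriv01 f y - 1) * h"
      "(\<bar>deriv01 f x - 1\<bar> - w) * h \<le> (deriv01 f z - 1) * h"
      using True ty tz h by (auto intro!: mult_right_mono)
    then show ?thesis using big y(3) z(3) by linarith
  next
    case False
    have "(\<bar>deriv01 f x - 1\<bar> - w) * h \<le> - (deriv01 f y - 1) * h"
      "(\<bar>deriv01 f x - 1\<bar> - w) * h \<le> - (deriv01 f z - 1) * h"
      using False ty tz h by (auto intro!: mult_right_mono)
    then show ?thesis using big y(3) z(3) by linarith
  qed
  then have "0 \<in> J" using icc[OF mem] icc[OF mem(2) mem(1)] by (auto simp: subset_iff)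
  then obtain p where "p \<in> {x - h..x + h}" "f p = p" by (auto simp: J_def)
  moreover from this have "p \<in> {0..1}" "\<bar>x - p\<bar> \<le> h" using sub by (blast, auto simp: abs_le_iff)
  ultimately show False using no_fix by blast
qed


lemma displacement_step:
  assumes x: "x \<in> {0..1}"
  obtains \<xi> where "\<xi> \<in> {0..1}" "\<bar>\<xi> - x\<bar> \<le> \<bar>f x - x\<bar>" "f (f x) - f x = deriv01 f \<xi> * (f x - x)"
  using mean_value01[of f "deriv01 f", OF has_deriv x maps[OF x]] by blast

text \<open>
  Since \<open>f'\<close> is positive, the displacement keeps its sign along an orbit. The sum is therefore the
  distance between the two ends of the orbit segment.
\<close>

lemma sum_displacement_le_one:
  assumes x: "x \<in> {0..1}"
  shows "(\<Sum>k<n. \<bar>f ((f ^^ k) x) - (f ^^ k) x\<bar>) \<le> 1"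
proof -
  define d where "d k = f ((f ^^ k) x) - (f ^^ k) x" for k
  have sg: "sgn (d k) = sgn (d 0)" for k
  proof (induction k)
    case (Suc k)
    obtain \<xi> where "\<xi> \<in> {0..1}" "d (Suc k) = deriv01 f \<xi> * d k"
      using displacement_step[OF iterate_maps[OF x, of k]] unfolding d_def by auto
    then show ?case using Suc deriv_pos[of \<xi>] by (simp add: sgn_mult)
  qed simp
  have "(\<Sum>k<n. \<bar>d k\<bar>) = (\<Sum>k<n. d k * sgn (d 0))"
    by (intro sum.cong refl) (metis abs_sgn sg)
  also have "\<dots> = (\<Sum>k<n. d k) * sgn (d 0)" by (simp add: sum_distrib_right)
  also have "(\<Sum>k<n. d k) = (f ^^ n) x - x"
    using sum_lessThan_telescope[of "\<lambda>k. (f ^^ k) x" n] by (simp add: d_def)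
  also have "\<dots> * sgn (d 0) \<le> 1"
    using iterate_maps[OF x, of n] x by (auto simp: sgn_if)
  finally show ?thesis by (simp add: d_def)
qed

text \<open>
  Because \<open>f'\<close> is bounded away from \<open>0\<close>, \<open>ln f'\<close> inherits from it the oscillation bound and the
  smallness near fixed points. This is what allows \<open>x\<^sub>k\<close> to be exchanged for the mean value point
  \<open>\<xi>\<^sub>k\<close>, and what makes \<open>L k = ln \<bar>\<phi> x\<^sub>k\<bar>\<close> move slowly wherever the displacement is small.
\<close>

lemma log_deriv_sum_bound:
  assumes mod: "modulus_of_continuity \<omega>" and pos: "0 < \<omega> 1"
    and fixed: "\<And>p. p \<in> {0..1} \<Longrightarrow> f p = p \<Longrightarrow> deriv01 f p = 1"
    and K: "0 \<le> K"
    and osc: "\<And>u v. u \<in> {0..1} \<Longrightarrow> v \<in> {0..1} \<Longrightarrow>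
      \<bar>deriv01 f u - deriv01 f v\<bar> \<le> K * \<omega> \<bar>u - v\<bar>"
    and A: "0 \<le> A"
    and log: "\<And>n. n \<ge> 1 \<Longrightarrow> ln (real n) \<le> A * (real n * \<omega> (1 / real n))"
  obtains C where "\<And>n x. n \<ge> 1 \<Longrightarrow> x \<in> {0..1} \<Longrightarrow>
    \<bar>log_deriv_sum n x\<bar> \<le> C * (real n * \<omega> (1 / real n))"
proof -
  obtain m M where m: "0 < m" "\<And>x. x \<in> {0..1} \<Longrightarrow> m \<le> deriv01 f x"
    and M: "0 \<le> M" "\<And>x. x \<in> {0..1} \<Longrightarrow> \<bar>ln (deriv01 f x)\<bar> \<le> M"
    using deriv_bounds by metis
  have d0: "deriv01 f 0 = 1" using fixed[of 0] f_zero by simp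
  have ln_lip: "\<bar>ln (deriv01 f u) - ln (deriv01 f v)\<bar> \<le> \<bar>deriv01 f u - deriv01 f v\<bar> / m"
    if "u \<in> {0..1}" "v \<in> {0..1}" for u v
  proof -
    have one: "ln a - ln b \<le> \<bar>a - b\<bar> / m" if "m \<le> a" "m \<le> b" for a b :: real
    proof -
      have "ln a - ln b \<le> (a - b) / b" using that m by (intro ln_diff_le) auto
      also have "\<dots> \<le> \<bar>a - b\<bar> / b" using that m by (intro divide_right_mono) auto
      also have "\<dots> \<le> \<bar>a - b\<bar> / m" using that m by (intro divide_left_mono) auto
      finally show ?thesis .
    qed
    show ?thesis
      using one[of "deriv01 f u" "deriv01 f v"] one[of "deriv01 f v" "deriv01 f u"] m(2) that
      by (auto simp: abs_minus_commute abs_le_iff)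
  qed
  have ln_osc: "\<bar>ln (deriv01 f u) - ln (deriv01 f v)\<bar> \<le> K / m * \<omega> \<delta>"
    if uv: "u \<in> {0..1}" "v \<in> {0..1}" and d: "\<bar>u - v\<bar> \<le> \<delta>" "\<delta> \<le> 1" for u v \<delta>
  proof -
    have "\<bar>ln (deriv01 f u) - ln (deriv01 f v)\<bar> \<le> K * \<omega> \<bar>u - v\<bar> / m"
      using ln_lip[OF uv] osc[OF uv] m(1) by (meson divide_right_mono less_imp_le order_trans)
    also have "\<dots> \<le> K * \<omega> \<delta> / m"
      using modulus_mono[OF mod _ d] K m(1) by (intro divide_right_mono mult_left_mono) auto
    finally show ?thesis by simp
  qed
  define b where "b = - ln (min 1 (\<omega> 1))"
  have b0: "0 \<le> b" using pos by (auto simp: b_def min_def)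
  define C where "C = (1 + 5 * K) / m + 2 * A + (b + M) / \<omega> 1"
  have "\<bar>log_deriv_sum n x\<bar> \<le> C * (real n * \<omega> (1 / real n))"
    if n: "n \<ge> 1" and x: "x \<in> {0..1}" for n x
  proof -
    define W where "W = \<omega> (1 / real n)"
    have n0: "0 < real n" and n1: "1 / real n \<le> 1" using n by auto
    have W: "\<omega> 1 \<le> real n * W" unfolding W_def by (rule modulus_one_le[OF mod n])
    have W0: "0 \<le> W" unfolding W_def using modulus_nonneg[OF mod _ n1] by simp
    define X where "X k = (f ^^ k) x" for k
    define d where "d k = f (X k) - X k" for k
    have X: "X k \<in> {0..1}" for k unfolding X_def by (rule iterate_maps[OF x])
    have "\<exists>\<xi>. \<forall>k. \<xi> k \<in> {0..1} \<and> \<bar>\<xi> k - X k\<bar> \<le> \<bar>d k\<bar> \<and> d (Suc k) = deriv01 f (\<xi> k) * d k"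
    proof (intro choice allI)
      fix k
      show "\<exists>\<xi>. \<xi> \<in> {0..1} \<and> \<bar>\<xi> - X k\<bar> \<le> \<bar>d k\<bar> \<and> d (Suc k) = deriv01 f \<xi> * d k"
        using displacement_step[OF X[of k]] unfolding d_def X_def by auto
    qed
    then obtain \<xi> where xi: "\<And>k. \<xi> k \<in> {0..1}" "\<And>k. \<bar>X k - \<xi> k\<bar> \<le> \<bar>d k\<bar>"
      "\<And>k. d (Suc k) = deriv01 f (\<xi> k) * d k"
      by (metis abs_minus_commute)
    have d1: "\<bar>d k\<bar> \<le> 1" for k using X[of k] maps[OF X[of k]] by (auto simp: d_def)
    have lhs: "log_deriv_sum n x = (\<Sum>k<n. ln (deriv01 f (X k)))"
      by (simp add: log_deriv_sum_def X_def)
    show ?thesis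
    proof (cases "f x = x")
      case True
      have "X k = x" for k by (induction k) (auto simp: X_def True)
      then have "log_deriv_sum n x = 0" using fixed[OF x True] by (simp add: lhs)
      moreover have "0 \<le> C"
        using K m(1) A b0 M(1) pos by (simp add: C_def)
      ultimately show ?thesis using W0 unfolding W_def by simp
    next
      case False
      have dn: "d k \<noteq> 0" for k
      proof (induction k)
        case (Suc k)
        then show ?case using xi(3)[of k] deriv_pos[OF xi(1)[of k]] by simp
      qed (use False in \<open>simp add: d_def X_def\<close>)
      define L where "L k = ln \<bar>d k\<bar>" for k
      have L_step: "L (Suc k) - L k = ln (deriv01 f (\<xi> k))" for k
        using dn[of k] deriv_pos[OF xi(1)[of k]] by (simp add: L_def xi(3) abs_mult ln_mult)
      have L0: "L k \<le> 0" for k using d1[of k] dn[of k] by (simp add: L_def)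
      have step: "\<bar>L (Suc k) - L k\<bar> \<le> M" for k unfolding L_step by (rule M(2)[OF xi(1)])
      define \<epsilon> where "\<epsilon> = (1 + 3 * K) / m * W"
      \<comment> \<open>The level \<open>- B\<close> corresponds to a displacement \<open>min 1 (\<omega> 1) / n\<^sup>2\<close>. It is at most \<open>\<omega> (1/n) / n\<close>,
        so \<open>deriv_near_one\<close> can be used with \<open>h = 1/n\<close>, and its logarithm is of order \<open>ln n\<close>.\<close>
      define B where "B = 2 * ln (real n) + b"
      have slow: "\<bar>L (Suc k) - L k\<bar> \<le> \<epsilon>" if small: "L k \<le> - B" for k
      proof -
        have "\<bar>d k\<bar> = exp (L k)" using dn[of k] by (simp add: L_def)
        also have "\<dots> \<le> exp (- B)" using small by simp
        also have "\<dots> = min 1 (\<omega> 1) / (real n)\<^sup>2"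
          using n0 pos by (simp add: B_def b_def exp_diff exp_minus exp_double field_simps)
        finally have "real n * \<bar>d k\<bar> \<le> real n * (min 1 (\<omega> 1) / (real n)\<^sup>2)"
          using n0 by (intro mult_left_mono) auto
        also have "\<dots> = min 1 (\<omega> 1) / real n" using n0 by (simp add: power2_eq_square)
        finally have nd: "real n * \<bar>d k\<bar> \<le> min 1 (\<omega> 1) / real n" .
        have "min 1 (\<omega> 1) / real n \<le> 1 / real n" using n0 by (intro divide_right_mono) auto
        then have nd1: "real n * \<bar>d k\<bar> \<le> 1" using nd n1 by linarith
        have "min 1 (\<omega> 1) / real n \<le> \<omega> 1 / real n" using n0 by (intro divide_right_mono) auto
        also have "\<dots> \<le> W" using W n0 by (simp add: field_simps)
        finally have ndW: "real n * \<bar>d k\<bar> \<le> W" using nd by linarith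
        have "\<omega> \<bar>d k\<bar> \<le> (1 + real n * \<bar>d k\<bar>) * W"
          unfolding W_def by (rule modulus_affine_bound[OF mod n _ d1]) simp
        also have "\<dots> \<le> 2 * W" using nd1 W0 by (intro mult_right_mono) auto
        finally have "K / m * \<omega> \<bar>d k\<bar> \<le> K / m * (2 * W)"
          using K m(1) by (intro mult_left_mono) auto
        with ln_osc[OF X xi(1) xi(2) d1, of k]
        have near: "\<bar>ln (deriv01 f (X k)) - ln (deriv01 f (\<xi> k))\<bar> \<le> K / m * (2 * W)" by linarith
        have "\<bar>deriv01 f (X k) - 1\<bar> \<le> \<bar>f (X k) - X k\<bar> / (1 / real n) + K * W"
        proof (rule deriv_near_one[OF fixed _ _ X])
          fix u v :: real
          assume uv: "u \<in> {0..1}" "v \<in> {0..1}" "\<bar>u - v\<bar> \<le> 1 / real n"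
          have "K * \<omega> \<bar>u - v\<bar> \<le> K * W"
            unfolding W_def using modulus_mono[OF mod _ uv(3) n1] K by (intro mult_left_mono) auto
          with osc[OF uv(1,2)] show "\<bar>deriv01 f u - deriv01 f v\<bar> \<le> K * W" by linarith
        qed (use n0 in auto)
        also have "\<dots> = real n * \<bar>d k\<bar> + K * W" by (simp add: d_def)
        also have "\<dots> \<le> (1 + K) * W" using ndW by (simp add: algebra_simps)
        finally have "\<bar>deriv01 f (X k) - 1\<bar> / m \<le> (1 + K) * W / m"
          using m(1) by (intro divide_right_mono) auto
        then have "\<bar>ln (deriv01 f (X k))\<bar> \<le> (1 + K) * W / m"
          using ln_lip[OF X[of k], of 0] d0 by simp
        with near have "\<bar>ln (deriv01 f (\<xi> k))\<bar> \<le> (1 + K) * W / m + K / m * (2 * W)" by linarith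
        also have "\<dots> = \<epsilon>" using m(1) by (simp add: \<epsilon>_def field_simps)
        finally show ?thesis unfolding L_step .
      qed
      have B0: "0 \<le> B" using b0 n by (simp add: B_def)
      have e0: "0 \<le> \<epsilon>" using K m(1) W0 by (simp add: \<epsilon>_def)
      have "L n - L 0 \<le> B + real n * \<epsilon>"
        by (rule rise_le_if_slow_below[where L = L, OF L0 B0 e0 slow])
      moreover have "L 0 - L n \<le> B + M + real n * \<epsilon>"
        by (rule fall_le_if_slow_below[where L = L, OF L0 B0 e0 M(1) slow step])
      ultimately have "\<bar>L n - L 0\<bar> \<le> B + M + real n * \<epsilon>" using M(1) by linarith
      moreover have "\<bar>log_deriv_sum n x - (L n - L 0)\<bar> \<le> K / m * (2 * (real n * W))"
      proof -
        have "log_deriv_sum n x - (L n - L 0)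
            = (\<Sum>k<n. ln (deriv01 f (X k)) - ln (deriv01 f (\<xi> k)))"
          unfolding lhs using sum_lessThan_telescope[of L n]
          by (simp add: sum_subtractf[of "\<lambda>k. ln (deriv01 f (X k))"] L_step)
        also have "\<bar>\<dots>\<bar> \<le> (\<Sum>k<n. \<bar>ln (deriv01 f (X k)) - ln (deriv01 f (\<xi> k))\<bar>)"
          by (rule sum_abs)
        also have "\<dots> \<le> (\<Sum>k<n. K / m * \<omega> \<bar>d k\<bar>)"
          by (intro sum_mono ln_osc X xi d1)
        also have "\<dots> = K / m * (\<Sum>k<n. \<omega> \<bar>d k\<bar>)" by (simp add: sum_distrib_left)
        also have "\<dots> \<le> K / m * (2 * (real n * W))"
          unfolding W_def using K m(1) sum_displacement_le_one[OF x, of n]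
          by (intro mult_left_mono sum_modulus_le[OF mod n]) (auto simp: d_def X_def)
        finally show ?thesis .
      qed
      moreover have "B \<le> 2 * (A * (real n * W)) + b"
        unfolding B_def W_def using log[OF n] by simp
      moreover have "b + M \<le> (b + M) / \<omega> 1 * (real n * W)"
      proof -
        have "b + M = (b + M) / \<omega> 1 * \<omega> 1" using pos by simp
        also have "\<dots> \<le> (b + M) / \<omega> 1 * (real n * W)"
          using W b0 M(1) pos by (intro mult_left_mono) auto
        finally show ?thesis .
      qed
      ultimately have "\<bar>log_deriv_sum n x\<bar> \<le> K / m * (2 * (real n * W)) + 2 * (A * (real n * W))
          + (b + M) / \<omega> 1 * (real n * W) + real n * \<epsilon>" by linarith
      also have "\<dots> = C * (real n * W)"
        by (simp add: C_def \<epsilon>_def add_divide_distrib algebra_simps)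
      finally show ?thesis unfolding W_def .
    qed
  qed
  then show ?thesis by (rule that)
qed

end

lemma deriv_oscillation_le:
  assumes mod: "modulus_of_continuity \<omega>" and f: "f \<in> Diff0_mod \<omega>"
  obtains K where "0 \<le> K" "\<And>u v. u \<in> {0..1} \<Longrightarrow> v \<in> {0..1} \<Longrightarrow>
    \<bar>deriv01 f u - deriv01 f v\<bar> \<le> K * \<omega> \<bar>u - v\<bar>"
proof -
  obtain K where K: "\<And>\<delta>. \<delta> \<in> {0..1} \<Longrightarrow> osc_modulus (deriv01 f) \<delta> \<le> K * \<omega> \<delta>"
    using f unfolding Diff0_mod_def by blast
  have "continuous_on {0..1} (deriv01 f)" using f by (auto simp: Diff0_mod_def Diff0_def C1_on01_def)
  then have "bounded (deriv01 f ` {0..1})"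
    by (intro compact_imp_bounded compact_continuous_image) auto
  then obtain R where R: "\<And>x. x \<in> {0..1} \<Longrightarrow> \<bar>deriv01 f x\<bar> \<le> R"
    unfolding bounded_iff by fastforce
  have "\<bar>deriv01 f u - deriv01 f v\<bar> \<le> \<bar>K\<bar> * \<omega> \<bar>u - v\<bar>" if uv: "u \<in> {0..1}" "v \<in> {0..1}" for u v
  proof -
    have d: "\<bar>u - v\<bar> \<in> {0..1}" using uv by auto
    have "\<bar>deriv01 f u - deriv01 f v\<bar> \<le> osc_modulus (deriv01 f) \<bar>u - v\<bar>"
      unfolding osc_modulus_def
    proof (rule cSup_upper)
      show "bdd_above {\<bar>deriv01 f x - deriv01 f y\<bar> |x y. x \<in> {0..1} \<and> y \<in> {0..1} \<and> \<bar>x - y\<bar> \<le> \<bar>u - v\<bar>}"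
      proof (rule bdd_aboveI[of _ "2 * R"], clarify)
        fix x y :: real assume "x \<in> {0..1}" "y \<in> {0..1}"
        then show "\<bar>deriv01 f x - deriv01 f y\<bar> \<le> 2 * R" using R[of x] R[of y] by linarith
      qed
    qed (use uv in blast)
    also have "\<dots> \<le> K * \<omega> \<bar>u - v\<bar>" by (rule K[OF d])
    also have "\<dots> \<le> \<bar>K\<bar> * \<omega> \<bar>u - v\<bar>"
      using modulus_nonneg[OF mod] d by (intro mult_right_mono) auto
    finally show ?thesis .
  qed
  \<comment> \<open>The constant \<open>K\<close> may be negative where \<open>\<omega>\<close> vanishes identically, hence the absolute value.\<close>
  then show ?thesis using that[of "\<bar>K\<bar>"] by simp
qed

theorem theorem5:
  fixes \<omega> :: "real \<Rightarrow> real" and \<alpha> a :: real and f :: "real \<Rightarrow> real"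
  assumes "modulus_of_continuity \<omega>"
    and "0 < \<alpha>" and "\<alpha> < 1" and "0 < a" and "a < 1"
    and "antimono_on {0<..<a} (\<lambda>x. \<omega> x / x powr \<alpha>)"
    and "f \<in> Diff0_mod \<omega>"
    and "growth_rate f = 1"
  shows "\<exists>C. \<forall>n::nat. n \<ge> 1 \<longrightarrow> ln (growth_seq f n) \<le> C * (real n * \<omega> (1 / real n))"
proof -
  note mod = assms(1)
  interpret interval_diffeo f
    using assms(7) by unfold_locales (simp add: Diff0_mod_def)
  note fixed = deriv_fixed_point[OF assms(8)]
  obtain K where K: "0 \<le> K" and osc: "\<And>u v. u \<in> {0..1} \<Longrightarrow> v \<in> {0..1} \<Longrightarrow>
      \<bar>deriv01 f u - deriv01 f v\<bar> \<le> K * \<omega> \<bar>u - v\<bar>"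
    using deriv_oscillation_le[OF mod assms(7)] by blast
  have "\<exists>C. \<forall>n\<ge>1. \<forall>x\<in>{0..1}. \<bar>log_deriv_sum n x\<bar> \<le> C * (real n * \<omega> (1 / real n))"
  proof (cases "\<omega> 1 = 0")
    case True
    \<comment> \<open>In this degenerate case \<open>f'\<close> is constant, so \<open>f\<close> is the identity on the unit interval.\<close>
    have zero: "\<omega> t = 0" if "t \<in> {0..1}" for t
      using modulus_mono[OF mod, of t 1] modulus_nonneg[OF mod, of t] True that by auto
    have "deriv01 f u = 1" if u: "u \<in> {0..1}" for u
      using osc[OF u, of 0] fixed[of 0] f_zero zero[of u] u by simp
    then have "log_deriv_sum n x = 0" if "x \<in> {0..1}" for n x
      using iterate_maps[OF that] by (simp add: log_deriv_sum_def)
    then show ?thesis by (intro exI[of _ 0]) auto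
  next
    case False
    then have pos: "0 < \<omega> 1" using modulus_nonneg[OF mod, of 1] by simp
    obtain A where A: "0 \<le> A" "\<And>n. n \<ge> 1 \<Longrightarrow> ln (real n) \<le> A * (real n * \<omega> (1 / real n))"
      using ln_le_modulus[OF mod pos assms(3-6)] by blast
    show ?thesis using log_deriv_sum_bound[OF mod pos fixed K osc A] by metis
  qed
  then obtain C where C: "\<And>n x. n \<ge> 1 \<Longrightarrow> x \<in> {0..1} \<Longrightarrow>
      \<bar>log_deriv_sum n x\<bar> \<le> C * (real n * \<omega> (1 / real n))" by blast
  have "ln (growth_seq f n) \<le> C * (real n * \<omega> (1 / real n))" if "n \<ge> 1" for n
    unfolding growth_seq_eq ln_exp using C[OF that] by (intro cSUP_least) auto
  then show ?thesis by blast
qed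

end
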